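(* Let $W\ge 1$ and $r\ge 1$ be integers, and run the guarded-epoch filter with parameters $W,r$ and epoch length $\ell=\lceil W/r\rceil$ on an arbitrary stream $x_0,x_1,x_2,\ldots$. Then at every insertion time $t\ge 0$ (immediately after insertion number $t$ is completed), every key inserted during the last $W$ insertions is represented in at least one segment; that is, for every index $i$ with $\max(0,t-W+1)\le i\le t$, the key $x_i$ is represented at time $t$ in at least one of the segments $B_0,\ldots,B_r$.
   Context: Stream: a sequence $x_0,x_1,x_2,\ldots$ of keys from a universe $U$. $W$ is the target window length; the live set at time $t$ is $L_t=\{x_i:\max(0,t-W+1)\le i\le t\}$. Guarded-epoch filter: it has $r+1$ bit arrays (segments) $B_0,\ldots,B_r$, each of $s\ge 1$ bits, all initially zero, and a current-segment index $c$, initially $c=0$. Under a total budget of $m$ bits, $s=\lfloor m/(r+1)\rfloor$. The epoch length is $\ell=\lceil W/r\rceil$. Each key $x\in U$ has, in each segment, $k\ge 1$ fixed bit positions determined by hash functions (its Bloom positions). Insertion number $t$ (for $t=0,1,2,\ldots$) proceeds as follows: if $t>0$ and $t \bmod \ell=0$, set $c\leftarrow (c+1)\bmod (r+1)$ and clear $B_c$ (set all its bits to $0$); then insert $x_t$ by setting its $k$ Bloom positions in $B_c$ to $1$. No other operation modifies the segments. A query for a key $y$ tests the $k$ positions of $y$ in every segment and returns true if some segment has all of them equal to $1$. A key $x$ is represented at time $t$ in segment $B_j$ if some insertion of $x$ with number $i\le t$ was written to $B_j$ and $B_j$ has not been cleared since that write, up to and including insertion number $t$. *)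

theory Defs
  imports Complex_Main
begin

text \<open>
  A filter is a list of segments (bit arrays) together with the index of the current segment.
  Parameters used throughout: \<open>W\<close> is the window length, the segments are indexed by \<open>0..r\<close>,
  \<open>s\<close> is the number of bits per segment, and \<open>h x j q\<close> for \<open>q < k\<close> is the \<open>q\<close>-th Bloom position
  of the key \<open>x\<close> in segment \<open>j\<close>. The stream is \<open>xs\<close>.
\<close>

record gef_state =
  segments :: "bool list list"
  current :: nat

definition epoch_length :: "nat \<Rightarrow> nat \<Rightarrow> nat" where
  "epoch_length W r = nat \<lceil>real W / real r\<rceil>"

definition bloom_positions ::
  "('u \<Rightarrow> nat \<Rightarrow> nat \<Rightarrow> nat) \<Rightarrow> nat \<Rightarrow> 'u \<Rightarrow> nat \<Rightarrow> nat set" where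
  "bloom_positions h k x j = h x j ` {..<k}"

definition set_bits_at :: "nat set \<Rightarrow> bool list \<Rightarrow> bool list" where
  "set_bits_at P b = map (\<lambda>p. b ! p \<or> p \<in> P) [0..<length b]"

definition init_state :: "nat \<Rightarrow> nat \<Rightarrow> gef_state" where
  "init_state r s =
     \<lparr> segments = replicate (r + 1) (replicate s False), current = 0 \<rparr>"

definition rotates_at :: "nat \<Rightarrow> nat \<Rightarrow> nat \<Rightarrow> bool" where
  "rotates_at W r t \<longleftrightarrow> t > 0 \<and> t mod epoch_length W r = 0"

definition rotate_and_clear :: "nat \<Rightarrow> nat \<Rightarrow> gef_state \<Rightarrow> gef_state" where
  "rotate_and_clear r s S =
     (let c = (current S + 1) mod (r + 1)
      in \<lparr> segments = (segments S)[c := replicate s False], current = c \<rparr>)"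

definition write_key ::
  "nat \<Rightarrow> ('u \<Rightarrow> nat \<Rightarrow> nat \<Rightarrow> nat) \<Rightarrow> 'u \<Rightarrow> gef_state \<Rightarrow> gef_state" where
  "write_key k h x S =
     (let c = current S
      in S \<lparr> segments :=
               (segments S)[c := set_bits_at (bloom_positions h k x c) (segments S ! c)] \<rparr>)"

definition insertion ::
  "nat \<Rightarrow> nat \<Rightarrow> nat \<Rightarrow> nat \<Rightarrow> ('u \<Rightarrow> nat \<Rightarrow> nat \<Rightarrow> nat) \<Rightarrow> nat \<Rightarrow> 'u \<Rightarrow> gef_state \<Rightarrow> gef_state"
where
  "insertion W r s k h t x S =
     write_key k h x (if rotates_at W r t then rotate_and_clear r s S else S)"

text \<open>The state immediately after insertion number \<open>t\<close> is completed.\<close>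

primrec state_after ::
  "nat \<Rightarrow> nat \<Rightarrow> nat \<Rightarrow> nat \<Rightarrow> ('u \<Rightarrow> nat \<Rightarrow> nat \<Rightarrow> nat) \<Rightarrow> (nat \<Rightarrow> 'u) \<Rightarrow> nat \<Rightarrow> gef_state"
where
  "state_after W r s k h xs 0 = insertion W r s k h 0 (xs 0) (init_state r s)"
| "state_after W r s k h xs (Suc t) =
     insertion W r s k h (Suc t) (xs (Suc t)) (state_after W r s k h xs t)"

text \<open>
  Writing a key does not change the current index, so the segment written (and, if the insertion
  rotates, the segment cleared) by insertion \<open>t\<close> is the current segment of the state after it.
\<close>

definition written_to ::
  "nat \<Rightarrow> nat \<Rightarrow> nat \<Rightarrow> nat \<Rightarrow> ('u \<Rightarrow> nat \<Rightarrow> nat \<Rightarrow> nat) \<Rightarrow> (nat \<Rightarrow> 'u) \<Rightarrow> nat \<Rightarrow> nat \<Rightarrow> bool"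
where
  "written_to W r s k h xs t j \<longleftrightarrow> current (state_after W r s k h xs t) = j"

definition cleared_at ::
  "nat \<Rightarrow> nat \<Rightarrow> nat \<Rightarrow> nat \<Rightarrow> ('u \<Rightarrow> nat \<Rightarrow> nat \<Rightarrow> nat) \<Rightarrow> (nat \<Rightarrow> 'u) \<Rightarrow> nat \<Rightarrow> nat \<Rightarrow> bool"
where
  "cleared_at W r s k h xs t j \<longleftrightarrow>
     rotates_at W r t \<and> current (state_after W r s k h xs t) = j"

text \<open>
  Within one insertion the clearing precedes the write, so only clearings by insertions
  strictly after \<open>i\<close> come after the write of insertion \<open>i\<close>.
\<close>

definition represented ::
  "nat \<Rightarrow> nat \<Rightarrow> nat \<Rightarrow> nat \<Rightarrow> ('u \<Rightarrow> nat \<Rightarrow> nat \<Rightarrow> nat) \<Rightarrow> (nat \<Rightarrow> 'u) \<Rightarrow> nat \<Rightarrow> 'u \<Rightarrow> nat \<Rightarrow> bool"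
where
  "represented W r s k h xs t x j \<longleftrightarrow>
     (\<exists>i\<le>t. xs i = x \<and> written_to W r s k h xs i j \<and>
            (\<forall>u. i < u \<and> u \<le> t \<longrightarrow> \<not> cleared_at W r s k h xs u j))"

end

theory Submission
  imports Defs
begin

text \<open>
  The epoch of insertion \<open>t\<close> is \<open>t div \<ell>\<close>, and its segment is the epoch number modulo \<open>r + 1\<close>.
  A segment written in one epoch is therefore next cleared at the start of the epoch \<open>r + 1\<close>
  later, so at least \<open>r * \<ell> \<ge> W\<close> insertions strictly separate the write from the clearing.
\<close>

lemma window_le_epochs: "W \<le> r * epoch_length W r" if "r \<ge> 1"
proof -
  have "real W / real r \<le> real (epoch_length W r)"
    unfolding epoch_length_def by (rule real_nat_ceiling_ge)
  then have "real W \<le> real (r * epoch_length W r)"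
    using that by (simp add: field_simps)
  then show ?thesis
    by (simp only: of_nat_le_iff)
qed

lemma current_insertion:
  "current (insertion W r s k h t x S) =
     (if rotates_at W r t then (current S + 1) mod (r + 1) else current S)"
  by (simp add: insertion_def write_key_def rotate_and_clear_def Let_def)

text \<open>By \<open>div_Suc\<close>, the quotient by the epoch length rises exactly when
  \<open>Suc t\<close> is a multiple of it, which is the rotation condition. For epoch length 0 both
  sides stay 0, as \<open>n mod 0 = n\<close> and \<open>n div 0 = 0\<close>.\<close>

lemma current_state_after:
  "current (state_after W r s k h xs t) = (t div epoch_length W r) mod (r + 1)"
proof (induction t)
  case 0
  then show ?case
    by (simp add: current_insertion rotates_at_def init_state_def)
next
  case (Suc t)
  then show ?case
    by (simp add: current_insertion rotates_at_def div_Suc mod_Suc_eq)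
qed

lemma cleared_after_window:
  assumes "W \<ge> 1" and "r \<ge> 1" and "i < u"
    and "written_to W r s k h xs i j" and "cleared_at W r s k h xs u j"
  shows "i + W < u"
proof -
  define l where "l = epoch_length W r"
  have W: "W \<le> r * l"
    using window_le_epochs[OF \<open>r \<ge> 1\<close>] by (simp add: l_def)
  with \<open>W \<ge> 1\<close> have "l > 0"
    by (cases l) auto
  have u: "u = u div l * l"
    using assms(5) by (auto simp: cleared_at_def rotates_at_def l_def)
  \<comment> \<open>As \<open>u\<close> is the first index of its epoch, any smaller index lies in
    an earlier epoch. This excludes a zero gap, so the congruence below forces a gap of at least
    \<open>r + 1\<close>.\<close>
  have less: "i div l < u div l"
    using \<open>i < u\<close> \<open>l > 0\<close> u by (metis div_less_iff_less_mult)
  have "(u div l) mod (r + 1) = (i div l) mod (r + 1)"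
    using assms(4,5) by (simp add: written_to_def cleared_at_def current_state_after l_def)
  then have "r + 1 dvd u div l - i div l"
    using less by (simp add: mod_eq_dvd_iff_nat)
  with less have "r + 1 \<le> u div l - i div l"
    by (intro dvd_imp_le) auto
  with less have "i div l + 1 + r \<le> u div l"
    by linarith
  \<comment> \<open>At least \<open>r\<close> full epochs lie strictly between those of
    \<open>i\<close> and \<open>u\<close>; the epoch of \<open>i\<close> ends beyond
    \<open>i\<close>, which makes the final bound strict.\<close>
  then have "(i div l + 1) * l + r * l \<le> u"
    using u by (metis add_mult_distrib mult_le_mono1)
  moreover have "i < (i div l + 1) * l"
    using \<open>l > 0\<close> by (metis div_less_iff_less_mult less_add_one)
  ultimately show ?thesis
    using W by linarith
qed

theorem lemma1:
  fixes W r s k :: nat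
    and h :: "'u \<Rightarrow> nat \<Rightarrow> nat \<Rightarrow> nat"
    and xs :: "nat \<Rightarrow> 'u"
  assumes "W \<ge> 1" and "r \<ge> 1" and "s \<ge> 1" and "k \<ge> 1"
    and "\<And>x j q. j \<le> r \<Longrightarrow> q < k \<Longrightarrow> h x j q < s"
  shows "\<forall>t i. max 0 (int t - int W + 1) \<le> int i \<and> i \<le> t \<longrightarrow>
           (\<exists>j\<le>r. represented W r s k h xs t (xs i) j)"
proof (intro allI impI)
  fix t i
  assume window: "max 0 (int t - int W + 1) \<le> int i \<and> i \<le> t"
  define j where "j = current (state_after W r s k h xs i)"
  have "j \<le> r"
    by (simp add: j_def current_state_after flip: less_Suc_eq_le)
  have written: "written_to W r s k h xs i j"
    by (simp add: written_to_def j_def)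
  \<comment> \<open>The window bound gives \<open>t < i + W\<close>, so a clearing at
    \<open>u \<le> t\<close> would contradict \<open>i + W < u\<close>.\<close>
  have "\<not> cleared_at W r s k h xs u j" if "i < u" "u \<le> t" for u
    using cleared_after_window[OF assms(1,2) \<open>i < u\<close> written] window that by force
  with written window have "represented W r s k h xs t (xs i) j"
    unfolding represented_def by blast
  with \<open>j \<le> r\<close> show "\<exists>j\<le>r. represented W r s k h xs t (xs i) j"
    by blast
qed

end
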